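(* Let $\Omega\subset X$ be a $\nu$-measurable set with $0<\nu(\Omega)<\nu(X)$. Let $\lambda^0(\Omega)=\sup\{\lambda>0:0\in M(\chi_\Omega,\lambda)\}$, with $\lambda^0(\Omega)=0$ if there is no $\lambda>0$ such that $0\in M(\chi_\Omega,\lambda)$. Then $$\lambda^0(\Omega)=\inf\left\{\frac{P_m(E)}{\nu(\Omega)-\nu(\Omega\bigtriangleup E)}\ :\ E\subset X\ \nu\text{-measurable},\ \nu(\Omega\bigtriangleup E)<\nu(\Omega)\right\}.$$
   Context: Setting: $(X,d)$ is a Polish metric space with its Borel $\sigma$-algebra. A random walk $m=(m_x)_{x\in X}$ on $X$ is a family of Borel probability measures on $X$ such that $x\mapsto m_x(A)$ is Borel for every Borel $A\subset X$ and $\int_X d(z,y)\,dm_x(y)<\infty$ for all $x\in X$ and some (hence any) $z\in X$; $[X,d,m]$ is a metric random walk space. $\nu$ is a finite (nonzero) Radon measure on $X$ which is reversible for $m$: $dm_x(y)d\nu(x)=dm_y(x)d\nu(y)$ as measures on $X\times X$ (this implies invariance, $\nu(A)=\int_X m_x(A)\,d\nu(x)$). It is also assumed that $\frac1{\nu(X)}\nu$ is ergodic with respect to $m$: every Borel set $B$ with $m_x(B)=1$ for all $x\in B$ satisfies $\nu(B)=0$ or $\nu(B)=\nu(X)$. $m$-total variation: $TV_m(u)=\frac12\int_X\int_X|u(y)-u(x)|\,dm_x(y)\,d\nu(x)$. $m$-perimeter: $P_m(E)=\int_E\int_{X\setminus E}dm_x(y)\,d\nu(x)$. $A\bigtriangleup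 B=(A\setminus B)\cup(B\setminus A)$. $\mathcal E_m(u,f,\lambda)=TV_m(u)+\lambda\int_X|u-f|\,d\nu$, and $M(f,\lambda)$ is the set of $u\in L^1(X,\nu)$ minimizing $\mathcal E_m(\cdot,f,\lambda)$ over $L^1(X,\nu)$. "$0\in M(\chi_\Omega,\lambda)$" refers to the zero function. *)

theory Defs
  imports "HOL-Analysis.Analysis"
begin

definition random_walk :: "('a::polish_space \<Rightarrow> 'a measure) \<Rightarrow> bool" where
  "random_walk m \<longleftrightarrow>
     (\<forall>x. sets (m x) = sets borel \<and> emeasure (m x) UNIV = 1) \<and>
     (\<forall>A\<in>sets borel. (\<lambda>x. emeasure (m x) A) \<in> borel_measurable borel) \<and>
     (\<exists>z. \<forall>x. (\<integral>\<^sup>+ y. ennreal (dist z y) \<partial>m x) < \<infinity>)"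

definition radon_measure :: "'a::topological_space measure \<Rightarrow> bool" where
  "radon_measure \<nu> \<longleftrightarrow>
     sets \<nu> = sets borel \<and>
     (\<forall>x. \<exists>U. open U \<and> x \<in> U \<and> emeasure \<nu> U < \<infinity>) \<and>
     (\<forall>B\<in>sets borel. emeasure \<nu> B = (SUP K\<in>{K. compact K \<and> K \<subseteq> B}. emeasure \<nu> K))"

text \<open>
  The two sides are the values at \<open>A\<close> of \<open>dm\<^sub>x(y) d\<nu>(x)\<close> and of \<open>dm\<^sub>y(x) d\<nu>(y)\<close>,
  both regarded as measures in \<open>(x, y)\<close>.
\<close>
definition reversible :: "('a::topological_space \<Rightarrow> 'a measure) \<Rightarrow> 'a measure \<Rightarrow> bool" where
  "reversible m \<nu> \<longleftrightarrow>
     (\<forall>A\<in>sets (borel \<Otimes>\<^sub>M borel).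
        (\<integral>\<^sup>+ x. emeasure (m x) {y. (x, y) \<in> A} \<partial>\<nu>) =
        (\<integral>\<^sup>+ y. emeasure (m y) {x. (x, y) \<in> A} \<partial>\<nu>))"

definition ergodic :: "('a::topological_space \<Rightarrow> 'a measure) \<Rightarrow> 'a measure \<Rightarrow> bool" where
  "ergodic m \<nu> \<longleftrightarrow>
     (\<forall>B\<in>sets borel. (\<forall>x\<in>B. emeasure (m x) B = 1) \<longrightarrow>
        emeasure \<nu> B = 0 \<or> emeasure \<nu> B = emeasure \<nu> UNIV)"

text \<open>
  The notions below refer to \<open>\<nu>\<close>-measurable sets and functions, that is, to measurability with
  respect to the completion of \<open>\<nu>\<close>. Since \<open>\<nu>\<close> is invariant, such a set or function is measurable
  with respect to the completion of \<open>m x\<close> for \<open>\<nu>\<close>-almost every \<open>x\<close> only; the values of the inner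
  integrals at the remaining \<open>x\<close> do not affect the outer ones.

  The functionals take values in \<open>[0, \<infinity>]\<close>, so that suprema and infima need no side conditions.
\<close>

definition total_variation :: "('a \<Rightarrow> 'a measure) \<Rightarrow> 'a measure \<Rightarrow> ('a \<Rightarrow> real) \<Rightarrow> ennreal" where
  "total_variation m \<nu> u =
     (1 / 2) * (\<integral>\<^sup>+ x. (\<integral>\<^sup>+ y. ennreal \<bar>u y - u x\<bar> \<partial>completion (m x)) \<partial>completion \<nu>)"

definition perimeter :: "('a \<Rightarrow> 'a measure) \<Rightarrow> 'a measure \<Rightarrow> 'a set \<Rightarrow> ennreal" where
  "perimeter m \<nu> E = (\<integral>\<^sup>+ x\<in>E. emeasure (completion (m x)) (UNIV - E) \<partial>completion \<nu>)"

definition energy ::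
  "('a \<Rightarrow> 'a measure) \<Rightarrow> 'a measure \<Rightarrow> ('a \<Rightarrow> real) \<Rightarrow> real \<Rightarrow> ('a \<Rightarrow> real) \<Rightarrow> ennreal" where
  "energy m \<nu> f lam u =
     total_variation m \<nu> u + ennreal lam * (\<integral>\<^sup>+ x. ennreal \<bar>u x - f x\<bar> \<partial>completion \<nu>)"

definition minimizers ::
  "('a \<Rightarrow> 'a measure) \<Rightarrow> 'a measure \<Rightarrow> ('a \<Rightarrow> real) \<Rightarrow> real \<Rightarrow> ('a \<Rightarrow> real) set" where
  "minimizers m \<nu> f lam =
     {u. integrable (completion \<nu>) u \<and>
         (\<forall>v. integrable (completion \<nu>) v \<longrightarrow> energy m \<nu> f lam u \<le> energy m \<nu> f lam v)}"

definition lambda0 :: "('a \<Rightarrow> 'a measure) \<Rightarrow> 'a measure \<Rightarrow> 'a set \<Rightarrow> ennreal" where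
  "lambda0 m \<nu> \<Omega> =
     (let L = {lam. 0 < lam \<and> (\<lambda>x. 0) \<in> minimizers m \<nu> (indicator \<Omega>) lam}
      in if L = {} then 0 else (SUP lam\<in>L. ennreal lam))"

end

theory Submission
  imports Defs "HOL-Probability.Giry_Monad"
begin

text \<open>
  The zero function is compared with arbitrary competitors by cutting them into level sets. Both
  terms of the energy are integrals over levels: the total variation of \<open>u\<close> is the integral over
  \<open>t\<close> of the perimeter of \<open>{u > t}\<close> (the coarea formula, \<open>coarea\<close> with
  \<open>total_variation_indicator\<close>), and \<open>\<integral>\<bar>u - \<chi>\<^sub>\<Omega>\<bar> d\<nu>\<close> is the integral over \<open>t\<close> of the measure of
  \<open>{u > t} \<triangle> {\<chi>\<^sub>\<Omega> > t}\<close> (the layer-cake formula \<open>nn_integral_abs_diff_layer_cake\<close>). For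
  \<open>0 < t < 1\<close> the set \<open>{\<chi>\<^sub>\<Omega> > t}\<close> is \<open>\<Omega>\<close> itself. If the energy \<open>\<lambda> \<nu>(\<Omega>)\<close> of the zero function
  is at most the energy \<open>P\<^sub>m(E) + \<lambda> \<nu>(\<Omega> \<triangle> E)\<close> of every indicator \<open>\<chi>\<^sub>E\<close>, then integrating this
  inequality for \<open>E = {u > t}\<close> over the unit interval \<open>0 < t < 1\<close> bounds \<open>\<lambda> \<nu>(\<Omega>)\<close> by the energy
  of \<open>u\<close>. So only indicators need to be tested (\<open>zero_minimizer_iff\<close>).

  The inequality for \<open>\<chi>\<^sub>E\<close> is automatic when \<open>\<nu>(\<Omega> \<triangle> E) \<ge> \<nu>(\<Omega>)\<close>, and otherwise says that \<open>\<lambda>\<close> is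
  at most \<open>P\<^sub>m(E) / (\<nu>(\<Omega>) - \<nu>(\<Omega> \<triangle> E))\<close>. The admissible \<open>\<lambda>\<close> are therefore exactly the positive
  reals below the infimum, and their supremum is that infimum.

  The coarea formula rests on Tonelli's theorem for the kernel \<open>m\<close>, which needs Borel functions. A
  \<open>\<nu>\<close>-measurable function is replaced by a Borel one that agrees with it off a \<open>\<nu>\<close>-null set; by
  invariance such a set is \<open>m x\<close>-null for almost every \<open>x\<close> (\<open>AE_walk\<close>), so the total variation
  does not change.
\<close>

section \<open>Layer-cake representation of the distance of two functions\<close>

text \<open>
  The levels \<open>t\<close> that separate \<open>a\<close> from \<open>b\<close> are those with \<open>min a b \<le> t < max a b\<close>. Writing
  \<open>indicator {t<..} (u x)\<close> for the indicator of \<open>{u > t}\<close> at \<open>x\<close> keeps it an explicit function of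
  \<open>t\<close> and \<open>u x\<close>, which is what joint measurability in \<open>(t, x)\<close> needs.
\<close>
lemma nn_integral_abs_diff_indicator_levels:
  fixes a b :: real
  shows "(\<integral>\<^sup>+ t. ennreal \<bar>indicator {t<..} a - indicator {t<..} b\<bar> \<partial>lborel) = ennreal \<bar>a - b\<bar>"
proof -
  have "(\<integral>\<^sup>+ t. ennreal \<bar>indicator {t<..} a - indicator {t<..} b\<bar> \<partial>lborel)
      = (\<integral>\<^sup>+ t. indicator {min a b..<max a b} t \<partial>lborel)"
    by (intro nn_integral_cong) (auto simp: indicator_def min_def max_def)
  also have "\<dots> = ennreal (max a b - min a b)"
    by simp
  also have "max a b - min a b = \<bar>a - b\<bar>"
    by auto
  finally show ?thesis .
qed

lemma borel_measurable_indicator_levels [measurable (raw)]: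
  fixes f g :: "'b \<Rightarrow> real"
  assumes [measurable]: "f \<in> borel_measurable M" "g \<in> borel_measurable M"
  shows "(\<lambda>x. indicator {f x<..} (g x) :: real) \<in> borel_measurable M"
proof -
  have "(\<lambda>x. indicator {f x<..} (g x) :: real) = (\<lambda>x. if f x < g x then 1 else 0)"
    by (auto simp: indicator_def)
  then show ?thesis
    by simp
qed

lemma (in sigma_finite_measure) nn_integral_abs_diff_layer_cake:
  fixes u v :: "'a \<Rightarrow> real"
  assumes [measurable]: "u \<in> borel_measurable M" "v \<in> borel_measurable M"
  shows "(\<integral>\<^sup>+ x. ennreal \<bar>u x - v x\<bar> \<partial>M)
    = (\<integral>\<^sup>+ t. (\<integral>\<^sup>+ x. ennreal \<bar>indicator {t<..} (u x) - indicator {t<..} (v x)\<bar> \<partial>M) \<partial>lborel)"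
proof -
  interpret pair_sigma_finite M "lborel :: real measure" ..
  have "(\<integral>\<^sup>+ x. ennreal \<bar>u x - v x\<bar> \<partial>M)
      = (\<integral>\<^sup>+ x. (\<integral>\<^sup>+ t. ennreal \<bar>indicator {t<..} (u x) - indicator {t<..} (v x)\<bar> \<partial>lborel) \<partial>M)"
    by (simp add: nn_integral_abs_diff_indicator_levels)
  also have "\<dots> = (\<integral>\<^sup>+ t. (\<integral>\<^sup>+ x. ennreal \<bar>indicator {t<..} (u x) - indicator {t<..} (v x)\<bar> \<partial>M) \<partial>lborel)"
    by (intro Fubini'[symmetric]) measurable
  finally show ?thesis .
qed

lemma nn_integral_abs_diff_indicator:
  assumes [measurable]: "A \<in> sets M" "B \<in> sets M"
  shows "(\<integral>\<^sup>+ x. ennreal \<bar>indicator A x - indicator B x\<bar> \<partial>M) = emeasure M ((B - A) \<union> (A - B))"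
proof -
  have "(\<integral>\<^sup>+ x. ennreal \<bar>indicator A x - indicator B x\<bar> \<partial>M)
      = (\<integral>\<^sup>+ x. indicator ((B - A) \<union> (A - B)) x \<partial>M)"
    by (intro nn_integral_cong) (auto simp: indicator_def)
  then show ?thesis
    by simp
qed

section \<open>Reversible walks\<close>

locale reversible_walk =
  fixes m :: "'a::polish_space \<Rightarrow> 'a measure" and \<nu> :: "'a measure"
  assumes walk: "random_walk m"
    and sets_nu [measurable_cong, simp]: "sets \<nu> = sets borel"
    and finite_nu: "emeasure \<nu> UNIV < \<infinity>"
    and reversible: "reversible m \<nu>"
begin

lemma space_nu [simp]: "space \<nu> = UNIV"
  using sets_eq_imp_space_eq[OF sets_nu] by simp

lemma sets_walk [simp, measurable_cong]: "sets (m x) = sets borel"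
  using walk by (auto simp: random_walk_def)

lemma space_walk [simp]: "space (m x) = UNIV"
  using sets_eq_imp_space_eq[OF sets_walk] by simp

lemma prob_space_walk: "prob_space (m x)"
  using walk by (intro prob_spaceI) (auto simp: random_walk_def)

lemma walk_kernel: "m \<in> borel \<rightarrow>\<^sub>M subprob_algebra borel"
  using walk
  by (intro measurable_subprob_algebra prob_space_imp_subprob_space prob_space_walk)
     (auto simp: random_walk_def)

lemma finite_measure_nu: "finite_measure \<nu>"
  using finite_nu by (intro finite_measureI) auto

lemma finite_measure_completion_nu: "finite_measure (completion \<nu>)"
proof (rule finite_measureI)
  have "UNIV \<in> sets \<nu>"
    by simp
  then have "emeasure (completion \<nu>) UNIV = emeasure \<nu> UNIV"
    by (subst emeasure_completion) auto
  then show "emeasure (completion \<nu>) (space (completion \<nu>)) \<noteq> \<infinity>"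
    using finite_nu by simp
qed

text \<open>Reversibility on the cylinder \<open>UNIV \<times> B\<close>, since each \<open>m y\<close> has total mass one.\<close>
lemma invariant:
  assumes "B \<in> sets borel"
  shows "(\<integral>\<^sup>+ x. emeasure (m x) B \<partial>\<nu>) = emeasure \<nu> B"
proof -
  have "UNIV \<times> B \<in> sets (borel \<Otimes>\<^sub>M borel)"
    using assms by (intro pair_measureI) auto
  then have "(\<integral>\<^sup>+ x. emeasure (m x) {y. (x, y) \<in> UNIV \<times> B} \<partial>\<nu>) =
      (\<integral>\<^sup>+ y. emeasure (m y) {x. (x, y) \<in> UNIV \<times> B} \<partial>\<nu>)"
    using reversible unfolding reversible_def by blast
  also have "\<dots> = (\<integral>\<^sup>+ y. indicator B y \<partial>\<nu>)"
    using walk by (intro nn_integral_cong) (auto simp: indicator_def random_walk_def)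
  finally show ?thesis
    using assms by simp
qed

text \<open>
  By invariance the function \<open>\<lambda>x. m x N\<close> has integral \<open>\<nu> N = 0\<close> for a null set \<open>N\<close>. This is what
  allows changes on \<open>\<nu>\<close>-null sets inside the inner integrals.
\<close>
lemma AE_walk:
  assumes "AE x in \<nu>. P x"
  shows "AE x in \<nu>. AE y in m x. P y"
proof -
  obtain N where N: "N \<in> sets \<nu>" "emeasure \<nu> N = 0" "{x \<in> space \<nu>. \<not> P x} \<subseteq> N"
    using assms by (auto elim: AE_E)
  have [measurable]: "N \<in> sets borel"
    using N by simp
  have "(\<lambda>x. emeasure (m x) N) \<in> borel_measurable \<nu>"
    using walk \<open>N \<in> sets borel\<close>
    by (simp add: random_walk_def cong: measurable_cong_sets[OF sets_nu refl])
  then have "AE x in \<nu>. emeasure (m x) N = 0"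
    using invariant[OF \<open>N \<in> sets borel\<close>] N by (simp add: nn_integral_0_iff_AE)
  then show ?thesis
  proof (eventually_elim)
    case (elim x)
    then show ?case
      using N by (intro AE_I[of _ _ N]) auto
  qed
qed

lemma total_variation_cong_AE:
  assumes "AE x in \<nu>. u x = v x"
  shows "total_variation m \<nu> u = total_variation m \<nu> v"
proof -
  have "AE x in \<nu>. (\<integral>\<^sup>+ y. ennreal \<bar>u y - u x\<bar> \<partial>m x) = (\<integral>\<^sup>+ y. ennreal \<bar>v y - v x\<bar> \<partial>m x)"
    using assms AE_walk[OF assms]
  proof eventually_elim
    case (elim x)
    from elim(2) show ?case
      by (intro nn_integral_cong_AE) (auto simp: elim(1))
  qed
  then show ?thesis
    unfolding total_variation_def nn_integral_completion by (simp add: nn_integral_cong_AE)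
qed

section \<open>Coarea formula\<close>

lemma borel_measurable_nn_integral_walk:
  fixes f :: "'b \<Rightarrow> 'a \<Rightarrow> 'a \<Rightarrow> ennreal"
  assumes [measurable]: "(\<lambda>(t, x, y). f t x y) \<in> borel_measurable (M \<Otimes>\<^sub>M borel \<Otimes>\<^sub>M borel)"
  shows "(\<lambda>(t, x). \<integral>\<^sup>+ y. f t x y \<partial>m x) \<in> borel_measurable (M \<Otimes>\<^sub>M borel)"
proof -
  have "(\<lambda>p. \<integral>\<^sup>+ y. f (fst p) (snd p) y \<partial>m (snd p)) \<in> borel_measurable (M \<Otimes>\<^sub>M borel)"
  proof (rule nn_integral_measurable_subprob_algebra2)
    show "(\<lambda>(p, y). f (fst p) (snd p) y) \<in> borel_measurable ((M \<Otimes>\<^sub>M borel) \<Otimes>\<^sub>M borel)"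
      using measurable_compose[OF _ assms, of "\<lambda>((t, x), y). (t, x, y)" "(M \<Otimes>\<^sub>M borel) \<Otimes>\<^sub>M borel"]
      by (simp add: case_prod_beta')
    show "(\<lambda>p. m (snd p)) \<in> M \<Otimes>\<^sub>M borel \<rightarrow>\<^sub>M subprob_algebra borel"
      by (rule measurable_compose[OF measurable_snd walk_kernel])
  qed
  then show ?thesis
    by (simp add: case_prod_beta')
qed

text \<open>
  The layer-cake formula on each \<open>m x\<close>, applied to \<open>u\<close> and the constant \<open>u x\<close>, followed by Tonelli's
  theorem for \<open>\<nu>\<close> and the levels. The second part makes it possible to add the integral over
  levels of another function.
\<close>
lemma coarea_borel:
  assumes u [measurable]: "u \<in> borel_measurable borel"
  shows "total_variation m \<nu> u = (\<integral>\<^sup>+ t. total_variation m \<nu> (\<lambda>x. indicator {t<..} (u x)) \<partial>lborel)"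
    and "(\<lambda>t. total_variation m \<nu> (\<lambda>x. indicator {t<..} (u x))) \<in> borel_measurable lborel"
proof -
  let ?g = "\<lambda>t x y. ennreal \<bar>indicator {t<..} (u y) - indicator {t<..} (u x)\<bar>"
  interpret nu: finite_measure \<nu>
    by (rule finite_measure_nu)
  interpret P: pair_sigma_finite \<nu> "lborel :: real measure" ..
  have "(\<lambda>(t, x). \<integral>\<^sup>+ y. ?g t x y \<partial>m x) \<in> borel_measurable (lborel \<Otimes>\<^sub>M borel)"
    by (rule borel_measurable_nn_integral_walk) measurable
  then have G [measurable]: "(\<lambda>(t, x). \<integral>\<^sup>+ y. ?g t x y \<partial>m x) \<in> borel_measurable (lborel \<Otimes>\<^sub>M \<nu>)"
    by (simp cong: measurable_cong_sets sets_pair_measure_cong)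
  have G' : "(\<lambda>(x, t). \<integral>\<^sup>+ y. ?g t x y \<partial>m x) \<in> borel_measurable (\<nu> \<Otimes>\<^sub>M lborel)"
    using measurable_compose[OF measurable_pair_swap' G] by (simp add: case_prod_beta')
  have H: "(\<lambda>t. \<integral>\<^sup>+ x. (\<integral>\<^sup>+ y. ?g t x y \<partial>m x) \<partial>\<nu>) \<in> borel_measurable lborel"
    by measurable
  have "(\<integral>\<^sup>+ x. (\<integral>\<^sup>+ y. ennreal \<bar>u y - u x\<bar> \<partial>m x) \<partial>\<nu>)
      = (\<integral>\<^sup>+ x. (\<integral>\<^sup>+ t. (\<integral>\<^sup>+ y. ?g t x y \<partial>m x) \<partial>lborel) \<partial>\<nu>)"
  proof (intro nn_integral_cong)
    fix x
    interpret mx: prob_space "m x"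
      by (rule prob_space_walk)
    show "(\<integral>\<^sup>+ y. ennreal \<bar>u y - u x\<bar> \<partial>m x) = (\<integral>\<^sup>+ t. (\<integral>\<^sup>+ y. ?g t x y \<partial>m x) \<partial>lborel)"
      by (intro mx.nn_integral_abs_diff_layer_cake) measurable
  qed
  also have "\<dots> = (\<integral>\<^sup>+ t. (\<integral>\<^sup>+ x. (\<integral>\<^sup>+ y. ?g t x y \<partial>m x) \<partial>\<nu>) \<partial>lborel)"
    using P.Fubini'[OF G'] by simp
  finally show "total_variation m \<nu> u
      = (\<integral>\<^sup>+ t. total_variation m \<nu> (\<lambda>x. indicator {t<..} (u x)) \<partial>lborel)"
    using H by (simp add: total_variation_def nn_integral_completion nn_integral_cmult)
  show "(\<lambda>t. total_variation m \<nu> (\<lambda>x. indicator {t<..} (u x))) \<in> borel_measurable lborel"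
    using H by (simp add: total_variation_def nn_integral_completion)
qed

lemma coarea:
  assumes "u \<in> borel_measurable (completion \<nu>)"
  shows "total_variation m \<nu> u = (\<integral>\<^sup>+ t. total_variation m \<nu> (\<lambda>x. indicator {t<..} (u x)) \<partial>lborel)"
    and "(\<lambda>t. total_variation m \<nu> (\<lambda>x. indicator {t<..} (u x))) \<in> borel_measurable lborel"
proof -
  obtain u' where u': "u' \<in> borel_measurable \<nu>" "AE x in \<nu>. u x = u' x"
    using completion_ex_borel_measurable_real[OF assms] by auto
  have "u' \<in> borel_measurable borel"
    using u'(1) by (simp cong: measurable_cong_sets)
  moreover have "total_variation m \<nu> (\<lambda>x. indicator {t<..} (u x))
      = total_variation m \<nu> (\<lambda>x. indicator {t<..} (u' x))" for t
    using u'(2) by (intro total_variation_cong_AE) auto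
  ultimately show "total_variation m \<nu> u
      = (\<integral>\<^sup>+ t. total_variation m \<nu> (\<lambda>x. indicator {t<..} (u x)) \<partial>lborel)"
    and "(\<lambda>t. total_variation m \<nu> (\<lambda>x. indicator {t<..} (u x))) \<in> borel_measurable lborel"
    using coarea_borel[of u'] total_variation_cong_AE[OF u'(2)] by simp_all
qed

section \<open>The perimeter\<close>

text \<open>
  The double integral of \<open>\<bar>\<chi>\<^sub>E(y) - \<chi>\<^sub>E(x)\<bar>\<close> counts the flow from \<open>E\<close> to its complement and the flow
  back. Reversibility makes the two equal, which cancels the factor \<open>1 / 2\<close>.
\<close>
lemma total_variation_indicator_borel:
  assumes [measurable]: "E \<in> sets borel"
  shows "total_variation m \<nu> (indicator E) = (\<integral>\<^sup>+ x. indicator E x * emeasure (m x) (- E) \<partial>\<nu>)"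
proof -
  have "- E \<in> sets borel"
    by measurable
  then have [measurable]: "(\<lambda>x. emeasure (m x) (- E)) \<in> borel_measurable \<nu>"
      "(\<lambda>x. emeasure (m x) E) \<in> borel_measurable \<nu>"
    using walk assms
    by (simp_all add: random_walk_def cong: measurable_cong_sets[OF sets_nu refl])
  have "(- E) \<times> E \<in> sets (borel \<Otimes>\<^sub>M borel)"
    by (intro pair_measureI) auto
  then have "(\<integral>\<^sup>+ x. emeasure (m x) {y. (x, y) \<in> (- E) \<times> E} \<partial>\<nu>)
      = (\<integral>\<^sup>+ y. emeasure (m y) {x. (x, y) \<in> (- E) \<times> E} \<partial>\<nu>)"
    using reversible unfolding reversible_def by blast
  moreover have "emeasure (m x) {y. (x, y) \<in> (- E) \<times> E} = indicator (- E) x * emeasure (m x) E" for x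
    by (auto simp: indicator_def)
  moreover have "emeasure (m y) {x. (x, y) \<in> (- E) \<times> E} = indicator E y * emeasure (m y) (- E)" for y
    by (auto simp: indicator_def Compl_eq)
  ultimately have flow: "(\<integral>\<^sup>+ x. indicator (- E) x * emeasure (m x) E \<partial>\<nu>)
      = (\<integral>\<^sup>+ x. indicator E x * emeasure (m x) (- E) \<partial>\<nu>)"
    by simp
  have "(\<integral>\<^sup>+ y. ennreal \<bar>indicator E y - indicator E x\<bar> \<partial>m x)
      = indicator E x * emeasure (m x) (- E) + indicator (- E) x * emeasure (m x) E" for x
  proof -
    have "(\<integral>\<^sup>+ y. ennreal \<bar>indicator E y - indicator E x\<bar> \<partial>m x)
        = (\<integral>\<^sup>+ y. indicator (if x \<in> E then - E else E) y \<partial>m x)"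
      by (intro nn_integral_cong) (auto simp: indicator_def)
    also have "\<dots> = emeasure (m x) (if x \<in> E then - E else E)"
      by (rule nn_integral_indicator) auto
    finally show ?thesis
      by auto
  qed
  then have "(\<integral>\<^sup>+ x. (\<integral>\<^sup>+ y. ennreal \<bar>indicator E y - indicator E x\<bar> \<partial>m x) \<partial>\<nu>)
      = (\<integral>\<^sup>+ x. indicator E x * emeasure (m x) (- E) \<partial>\<nu>)
        + (\<integral>\<^sup>+ x. indicator (- E) x * emeasure (m x) E \<partial>\<nu>)"
    by (simp add: nn_integral_add)
  then have "total_variation m \<nu> (indicator E)
      = 1 / 2 * (2 * (\<integral>\<^sup>+ x. indicator E x * emeasure (m x) (- E) \<partial>\<nu>))"
    by (simp add: total_variation_def nn_integral_completion flow mult_2)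
  also have "\<dots> = (1 / 2 * 2) * (\<integral>\<^sup>+ x. indicator E x * emeasure (m x) (- E) \<partial>\<nu>)"
    by (simp only: mult.assoc)
  also have "1 / 2 * 2 = (1 :: ennreal)"
    by (simp add: ennreal_divide_times)
  finally show ?thesis
    by simp
qed

text \<open>
  If \<open>E\<close> differs from the Borel set \<open>E'\<close> only inside a \<open>\<nu>\<close>-null set, then for almost every \<open>x\<close> it is
  measurable for the completion of \<open>m x\<close> and has the same measure there as \<open>E'\<close>. For the remaining
  \<open>x\<close> the inner measure in the perimeter may be meaningless, but they form a null set.
\<close>
lemma total_variation_indicator:
  assumes E: "E \<in> sets (completion \<nu>)"
  shows "total_variation m \<nu> (indicator E) = perimeter m \<nu> E"
proof -
  obtain E' N' N where N: "E = E' \<union> N'" "N' \<subseteq> N" "N \<in> null_sets \<nu>" "E' \<in> sets \<nu>"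
    using E by (rule sets_completionE)
  have [measurable]: "E' \<in> sets borel" "N \<in> sets borel"
    using N by auto
  have ae: "AE x in \<nu>. x \<notin> N"
    using N(3) by (rule AE_not_in)
  have "AE x in \<nu>. indicator E' x * emeasure (m x) (- E')
      = emeasure (completion (m x)) (UNIV - E) * indicator E x"
    using ae AE_walk[OF ae]
  proof eventually_elim
    case (elim x)
    have "N \<in> null_sets (m x)"
      using elim(2) by (simp add: AE_iff_null_sets)
    then have "UNIV - E \<in> sets (completion (m x))"
      using N by (intro sets_completionI[of _ "- E' - N" "N - E" N]) auto
    moreover have "- E' \<in> sets (completion (m x))"
      by (rule sets_completionI_sets) auto
    moreover have "AE y in completion (m x). y \<in> UNIV - E \<longleftrightarrow> y \<in> - E'"
      using elim(2) N by (auto simp: AE_completion_iff)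
    ultimately have "emeasure (completion (m x)) (UNIV - E) = emeasure (completion (m x)) (- E')"
      by (intro emeasure_eq_AE)
    also have "\<dots> = emeasure (m x) (- E')"
      by (subst emeasure_completion) auto
    finally show ?case
      using elim(1) N by (auto simp: indicator_def)
  qed
  then have "(\<integral>\<^sup>+ x. indicator E' x * emeasure (m x) (- E') \<partial>\<nu>) = perimeter m \<nu> E"
    unfolding perimeter_def nn_integral_completion by (rule nn_integral_cong_AE)
  moreover have "total_variation m \<nu> (indicator E) = total_variation m \<nu> (indicator E')"
    using ae N by (intro total_variation_cong_AE) (auto simp: indicator_def)
  ultimately show ?thesis
    by (simp add: total_variation_indicator_borel)
qed

section \<open>When the zero function is a minimizer\<close>

text \<open>
  Indicators suffice as competitors: the energy of \<open>v\<close> is the integral over all levels \<open>t\<close> of the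
  energies of \<open>{v > t}\<close> relative to \<open>{\<chi>\<^sub>\<Omega> > t}\<close>, and the levels in the unit interval alone, where the
  latter set is \<open>\<Omega>\<close>, already contribute at least the energy of the zero function.
\<close>
lemma zero_minimizer_iff:
  assumes \<Omega>: "\<Omega> \<in> sets (completion \<nu>)"
  shows "(\<lambda>x. 0) \<in> minimizers m \<nu> (indicator \<Omega>) lam \<longleftrightarrow>
    (\<forall>E\<in>sets (completion \<nu>). ennreal lam * emeasure (completion \<nu>) \<Omega>
      \<le> perimeter m \<nu> E + ennreal lam * emeasure (completion \<nu>) ((\<Omega> - E) \<union> (E - \<Omega>)))"
    (is "_ \<longleftrightarrow> (\<forall>E\<in>_. ?c \<le> ?F E)")
proof -
  interpret cnu: finite_measure "completion \<nu>"
    by (rule finite_measure_completion_nu)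
  have energy_indicator: "energy m \<nu> (indicator \<Omega>) lam (indicator E) = ?F E"
    if "E \<in> sets (completion \<nu>)" for E
    using that \<Omega> by (simp only: energy_def total_variation_indicator nn_integral_abs_diff_indicator)
  have "perimeter m \<nu> {} = 0"
    by (simp add: perimeter_def)
  then have energy_zero: "energy m \<nu> (indicator \<Omega>) lam (\<lambda>x. 0) = ?c"
    using energy_indicator[of "{}"] by (simp add: indicator_def[abs_def] cong: if_cong)
  show ?thesis
  proof
    assume min: "(\<lambda>x. 0) \<in> minimizers m \<nu> (indicator \<Omega>) lam"
    show "\<forall>E\<in>sets (completion \<nu>). ?c \<le> ?F E"
    proof
      fix E assume E: "E \<in> sets (completion \<nu>)"
      then have "integrable (completion \<nu>) (indicator E :: 'a \<Rightarrow> real)"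
        by (simp add: cnu.emeasure_finite less_top[symmetric] integrable_indicator_iff del: emeasure_completion)
      then show "?c \<le> ?F E"
        using min energy_zero energy_indicator[OF E] by (auto simp: minimizers_def)
    qed
  next
    assume sets: "\<forall>E\<in>sets (completion \<nu>). ?c \<le> ?F E"
    have "?c \<le> energy m \<nu> (indicator \<Omega>) lam v" if "integrable (completion \<nu>) v" for v
    proof -
      have v [measurable]: "v \<in> borel_measurable (completion \<nu>)"
        using that by auto
      note \<Omega> [measurable]
      let ?T = "\<lambda>t. total_variation m \<nu> (\<lambda>x. indicator {t<..} (v x))"
      let ?D = "\<lambda>t. \<integral>\<^sup>+ x. ennreal \<bar>indicator {t<..} (v x) - indicator {t<..} (indicator \<Omega> x)\<bar>
        \<partial>completion \<nu>"
      have "?c = (\<integral>\<^sup>+ t. ?c * indicator {0<..<1::real} t \<partial>lborel)"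
        by (simp add: nn_integral_cmult_indicator)
      also have "\<dots> \<le> (\<integral>\<^sup>+ t. ?T t + ennreal lam * ?D t \<partial>lborel)"
      \<comment> \<open>Levels outside the unit interval are discarded: there the left-hand side is zero.\<close>
      proof (intro nn_integral_mono)
        fix t :: real
        let ?E = "{x. t < v x}"
        show "?c * indicator {0<..<1} t \<le> ?T t + ennreal lam * ?D t"
        proof (cases "0 < t \<and> t < 1")
          case True
          have "{x \<in> space (completion \<nu>). t < v x} \<in> sets (completion \<nu>)"
            by measurable
          then have E: "?E \<in> sets (completion \<nu>)"
            by simp
          have ind: "indicator {t<..} (v x) = (indicator ?E x :: real)"
            "indicator {t<..} (indicator \<Omega> x) = (indicator \<Omega> x :: real)" for x
            using True by (auto simp: indicator_def)
          have "?T t + ennreal lam * ?D t = energy m \<nu> (indicator \<Omega>) lam (indicator ?E)"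
            by (simp only: ind energy_def)
          then show ?thesis
            using sets E energy_indicator[OF E] by (auto simp: indicator_def)
        qed auto
      qed
      also have "\<dots> = (\<integral>\<^sup>+ t. ?T t \<partial>lborel) + ennreal lam * (\<integral>\<^sup>+ t. ?D t \<partial>lborel)"
        using coarea(2)[OF v] by (simp add: nn_integral_add nn_integral_cmult)
      also have "\<dots> = energy m \<nu> (indicator \<Omega>) lam v"
        unfolding energy_def coarea(1)[OF v]
        by (subst cnu.nn_integral_abs_diff_layer_cake) auto
      finally show ?thesis .
    qed
    then show "(\<lambda>x. 0) \<in> minimizers m \<nu> (indicator \<Omega>) lam"
      by (simp add: minimizers_def energy_zero)
  qed
qed

end

section \<open>The threshold as an infimum\<close>

lemma ennreal_mult_le_add_mult_iff_le_divide:
  fixes P s w :: ennreal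
  assumes "s < w" "w < \<infinity>"
  shows "ennreal l * w \<le> P + ennreal l * s \<longleftrightarrow> ennreal l \<le> P / (w - s)"
proof -
  have "ennreal l * w \<le> P + ennreal l * s \<longleftrightarrow> ennreal l * (w - s) \<le> P"
    using assms by (simp add: ennreal_right_diff_distrib ennreal_minus_le_iff ennreal_mult_eq_top_iff add.commute
        less_top[symmetric])
  also have "\<dots> \<longleftrightarrow> ennreal l \<le> P / (w - s)"
  proof -
    have "w - s \<noteq> 0" "w - s < top"
      using assms by (auto simp: diff_eq_0_iff_ennreal less_top[symmetric])
    then show ?thesis
      by (meson divide_less_ennreal not_le)
  qed
  finally show ?thesis .
qed

text \<open>
  For \<open>I = 0\<close> there is no positive real below \<open>I\<close>; this is the case for which the threshold has the
  default value \<open>0\<close>.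
\<close>
lemma SUP_positive_reals_below:
  fixes I :: ennreal
  defines "L \<equiv> {l. 0 < l \<and> ennreal l \<le> I}"
  shows "(if L = {} then 0 else SUP l\<in>L. ennreal l) = I"
proof (cases I)
  case (real r)
  show ?thesis
  proof (cases "r = 0")
    case True
    then show ?thesis
      using real by (auto simp: L_def)
  next
    case False
    then have "r \<in> L"
      using real by (auto simp: L_def)
    then have "(SUP l\<in>L. ennreal l) = I"
      using real by (intro antisym SUP_least) (auto simp: L_def intro: SUP_upper2)
    then show ?thesis
      using \<open>r \<in> L\<close> by auto
  qed
next
  case top
  have "(SUP n. of_nat n :: ennreal) \<le> (SUP l\<in>L. ennreal l)"
  proof (rule SUP_least)
    fix n
    have "of_nat n \<le> ennreal (real n + 1)"
      by (simp add: ennreal_of_nat_eq_real_of_nat)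
    moreover have "real n + 1 \<in> L"
      by (simp add: L_def top)
    ultimately show "of_nat n \<le> (SUP l\<in>L. ennreal l)"
      by (rule SUP_upper2[rotated])
  qed
  then have "(SUP l\<in>L. ennreal l) = top"
    by (simp add: ennreal_SUP_of_nat_eq_top top_unique)
  moreover have "1 \<in> L"
    by (simp add: L_def top)
  ultimately show ?thesis
    using top by auto
qed

theorem proposition3p33:
  fixes m :: "'a::polish_space \<Rightarrow> 'a measure" and \<nu> :: "'a measure" and \<Omega> :: "'a set"
  assumes "random_walk m"
    and "radon_measure \<nu>" and "0 < emeasure \<nu> UNIV" and "emeasure \<nu> UNIV < \<infinity>"
    and "reversible m \<nu>"
    and "ergodic m \<nu>"
    and "\<Omega> \<in> sets (completion \<nu>)"
    and "0 < emeasure (completion \<nu>) \<Omega>"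
    and "emeasure (completion \<nu>) \<Omega> < emeasure (completion \<nu>) UNIV"
  shows "lambda0 m \<nu> \<Omega> =
    (INF E\<in>{E \<in> sets (completion \<nu>).
        emeasure (completion \<nu>) ((\<Omega> - E) \<union> (E - \<Omega>)) < emeasure (completion \<nu>) \<Omega>}.
      perimeter m \<nu> E /
        (emeasure (completion \<nu>) \<Omega> - emeasure (completion \<nu>) ((\<Omega> - E) \<union> (E - \<Omega>))))"
    (is "_ = (INF E\<in>{E \<in> _. ?s E < ?w}. ?P E / (?w - ?s E))")
proof -
  interpret reversible_walk m \<nu>
    using assms by unfold_locales (auto simp: radon_measure_def)
  let ?I = "INF E\<in>{E \<in> sets (completion \<nu>). ?s E < ?w}. ?P E / (?w - ?s E)"
  have w: "?w < \<infinity>"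
    using finite_measure.emeasure_finite[OF finite_measure_completion_nu]
    by (simp add: less_top[symmetric] del: emeasure_completion)
  have "(\<lambda>x. 0) \<in> minimizers m \<nu> (indicator \<Omega>) l \<longleftrightarrow> ennreal l \<le> ?I" for l
  proof -
    have "ennreal l * ?w \<le> ?P E + ennreal l * ?s E \<longleftrightarrow>
        (?s E < ?w \<longrightarrow> ennreal l \<le> ?P E / (?w - ?s E))" for E
    proof (cases "?s E < ?w")
      case True
      then show ?thesis
        using ennreal_mult_le_add_mult_iff_le_divide[OF True w] by simp
    next
      case False
      then have "ennreal l * ?w \<le> ennreal l * ?s E"
        by (intro mult_left_mono) auto
      also have "\<dots> \<le> ?P E + ennreal l * ?s E"
        by simp
      finally show ?thesis
        using False by simp
    qed
    then show ?thesis
      unfolding zero_minimizer_iff[OF assms(7)] le_INF_iff by blast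
  qed
  then show ?thesis
    by (simp only: lambda0_def Let_def SUP_positive_reals_below)
qed

end
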